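(* Let $(\mathcal C,\otimes,I,\gamma)$ be a symmetric monoidal category and $(\mathcal T,\eta,\mu,\tau)$ a centralisable strong monad on it, and for each object $X$ let $(\mathcal ZX,\iota_X)$ be a terminal central cone of $\mathcal T$ at $X$. Then the assignment $X\mapsto\mathcal ZX$ extends to a commutative strong monad $(\mathcal Z,\eta^{\mathcal Z},\mu^{\mathcal Z},\tau^{\mathcal Z})$ on $\mathcal C$, and the morphisms $\iota_X:\mathcal ZX\to\mathcal TX$ constitute a monomorphism of strong monads $\iota:\mathcal Z\Rightarrow\mathcal T$; in particular $\mathcal Z$ is a commutative submonad of $\mathcal T$.
   Context: Right strength: $\tau'_{X,Y}=\mathcal T(\gamma_{Y,X})\circ\tau_{Y,X}\circ\gamma_{\mathcal TX,Y}$. A strong monad is commutative if $\mu_{X\otimes Y}\circ\mathcal T\tau'_{X,Y}\circ\tau_{\mathcal TX,Y}=\mu_{X\otimes Y}\circ\mathcal T\tau_{X,Y}\circ\tau'_{X,\mathcal TY}$ for all $X,Y$. A central cone of $\mathcal T$ at $X$ is a pair $(Z,\iota)$ with $\iota:Z\to\mathcal TX$ such that for every object $Y$, $\mu_{X\otimes Y}\circ\mathcal T\tau'_{X,Y}\circ\tau_{\mathcal TX,Y}\circ(\iota\otimes\mathrm{id}_{\mathcal TY})=\mu_{X\otimes Y}\circ\mathcal T\tau_{X,Y}\circ\tau'_{X,\mathcal TY}\circ(\iota\otimes\mathrm{id}_{\mathcal TY})$; a morphism of central cones $(Z',\iota')\to(Z,\iota)$ is $\varphi$ with $\iota\circ\varphi=\iota'$;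 a terminal central cone is a terminal object among central cones at $X$. $\mathcal T$ is centralisable if it has a terminal central cone at every object. A morphism of strong monads $\iota:\mathcal S\Rightarrow\mathcal T$ is a natural transformation with $\iota\circ\eta^{\mathcal S}=\eta^{\mathcal T}$, $\iota_X\circ\mu^{\mathcal S}_X=\mu^{\mathcal T}_X\circ\mathcal T\iota_X\circ\iota_{\mathcal SX}$, $\iota_{X\otimes Y}\circ\tau^{\mathcal S}_{X,Y}=\tau^{\mathcal T}_{X,Y}\circ(X\otimes\iota_Y)$; a (strong) submonad is given by a monomorphism in the category of strong monads on $\mathcal C$. *)

theory Defs
  imports Main
begin

text \<open>
  Categories have a set of objects of type \<open>'o\<close> and a set of arrows of type \<open>'a\<close>; nothing is
  assumed about the operations outside these sets. Composition is written in the
  usual order: \<open>g \<cdot> f\<close> means first \<open>f\<close>, then \<open>g\<close>.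
\<close>

record ('o, 'a) cat =
  Obj :: "'o set"
  Arr :: "'a set"
  Dom :: "'a \<Rightarrow> 'o"
  Cod :: "'a \<Rightarrow> 'o"
  Id :: "'o \<Rightarrow> 'a" ("\<one>\<index>")
  Comp :: "'a \<Rightarrow> 'a \<Rightarrow> 'a" (infixr "\<cdot>\<index>" 60)

definition hom :: "('o, 'a, 'm) cat_scheme \<Rightarrow> 'o \<Rightarrow> 'o \<Rightarrow> 'a set" ("Hom\<index>")
  where "hom C X Y = {f \<in> Arr C. Dom C f = X \<and> Cod C f = Y}"

locale category =
  fixes C :: "('o, 'a, 'm) cat_scheme" (structure)
  assumes Dom_Obj: "f \<in> Arr C \<Longrightarrow> Dom C f \<in> Obj C"
    and Cod_Obj: "f \<in> Arr C \<Longrightarrow> Cod C f \<in> Obj C"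
    and Id_hom: "X \<in> Obj C \<Longrightarrow> \<one> X \<in> Hom X X"
    and comp_hom: "\<lbrakk>f \<in> Hom X Y; g \<in> Hom Y Z\<rbrakk> \<Longrightarrow> g \<cdot> f \<in> Hom X Z"
    and comp_Id: "f \<in> Hom X Y \<Longrightarrow> f \<cdot> \<one> X = f"
    and Id_comp: "f \<in> Hom X Y \<Longrightarrow> \<one> Y \<cdot> f = f"
    and comp_assoc: "\<lbrakk>f \<in> Hom W X; g \<in> Hom X Y; h \<in> Hom Y Z\<rbrakk>
      \<Longrightarrow> (h \<cdot> g) \<cdot> f = h \<cdot> (g \<cdot> f)"

definition iso_arr :: "('o, 'a, 'm) cat_scheme \<Rightarrow> 'o \<Rightarrow> 'o \<Rightarrow> 'a \<Rightarrow> bool"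
  where "iso_arr C X Y f \<longleftrightarrow> f \<in> hom C X Y \<and>
    (\<exists>g \<in> hom C Y X. g \<cdot>\<^bsub>C\<^esub> f = \<one>\<^bsub>C\<^esub> X \<and> f \<cdot>\<^bsub>C\<^esub> g = \<one>\<^bsub>C\<^esub> Y)"

record ('o, 'a) moncat = "('o, 'a) cat" +
  tensor_obj :: "'o \<Rightarrow> 'o \<Rightarrow> 'o" (infixr "\<otimes>\<index>" 70)
  tensor_arr :: "'a \<Rightarrow> 'a \<Rightarrow> 'a" (infixr "\<boxtimes>\<index>" 70)
  unit_obj :: 'o ("\<I>\<index>")
  associator :: "'o \<Rightarrow> 'o \<Rightarrow> 'o \<Rightarrow> 'a" ("\<alpha>\<index>")
  lunitor :: "'o \<Rightarrow> 'a" ("\<ll>\<index>")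
  runitor :: "'o \<Rightarrow> 'a" ("\<rho>\<index>")

locale monoidal_category = category C
  for C :: "('o, 'a, 'm) moncat_scheme" (structure) +
  assumes tensor_Obj: "\<lbrakk>X \<in> Obj C; Y \<in> Obj C\<rbrakk> \<Longrightarrow> X \<otimes> Y \<in> Obj C"
    and tensor_hom: "\<lbrakk>f \<in> Hom X X'; g \<in> Hom Y Y'\<rbrakk> \<Longrightarrow> f \<boxtimes> g \<in> Hom (X \<otimes> Y) (X' \<otimes> Y')"
    and tensor_Id: "\<lbrakk>X \<in> Obj C; Y \<in> Obj C\<rbrakk> \<Longrightarrow> \<one> X \<boxtimes> \<one> Y = \<one> (X \<otimes> Y)"
    and tensor_comp: "\<lbrakk>f \<in> Hom X X'; f' \<in> Hom X' X''; g \<in> Hom Y Y'; g' \<in> Hom Y' Y''\<rbrakk>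
      \<Longrightarrow> (f' \<cdot> f) \<boxtimes> (g' \<cdot> g) = (f' \<boxtimes> g') \<cdot> (f \<boxtimes> g)"
    and unit_Obj: "\<I> \<in> Obj C"
    and associator_iso: "\<lbrakk>X \<in> Obj C; Y \<in> Obj C; Z \<in> Obj C\<rbrakk>
      \<Longrightarrow> iso_arr C ((X \<otimes> Y) \<otimes> Z) (X \<otimes> (Y \<otimes> Z)) (\<alpha> X Y Z)"
    and associator_natural: "\<lbrakk>f \<in> Hom X X'; g \<in> Hom Y Y'; h \<in> Hom Z Z'\<rbrakk>
      \<Longrightarrow> \<alpha> X' Y' Z' \<cdot> ((f \<boxtimes> g) \<boxtimes> h) = (f \<boxtimes> (g \<boxtimes> h)) \<cdot> \<alpha> X Y Z"
    and lunitor_iso: "X \<in> Obj C \<Longrightarrow> iso_arr C (\<I> \<otimes> X) X (\<ll> X)"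
    and lunitor_natural: "f \<in> Hom X Y \<Longrightarrow> \<ll> Y \<cdot> (\<one> \<I> \<boxtimes> f) = f \<cdot> \<ll> X"
    and runitor_iso: "X \<in> Obj C \<Longrightarrow> iso_arr C (X \<otimes> \<I>) X (\<rho> X)"
    and runitor_natural: "f \<in> Hom X Y \<Longrightarrow> \<rho> Y \<cdot> (f \<boxtimes> \<one> \<I>) = f \<cdot> \<rho> X"
    and triangle: "\<lbrakk>X \<in> Obj C; Y \<in> Obj C\<rbrakk>
      \<Longrightarrow> (\<one> X \<boxtimes> \<ll> Y) \<cdot> \<alpha> X \<I> Y = \<rho> X \<boxtimes> \<one> Y"
    and pentagon: "\<lbrakk>W \<in> Obj C; X \<in> Obj C; Y \<in> Obj C; Z \<in> Obj C\<rbrakk>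
      \<Longrightarrow> \<alpha> W X (Y \<otimes> Z) \<cdot> \<alpha> (W \<otimes> X) Y Z
        = (\<one> W \<boxtimes> \<alpha> X Y Z) \<cdot> \<alpha> W (X \<otimes> Y) Z \<cdot> (\<alpha> W X Y \<boxtimes> \<one> Z)"

record ('o, 'a) symmoncat = "('o, 'a) moncat" +
  braiding :: "'o \<Rightarrow> 'o \<Rightarrow> 'a" ("\<gamma>\<index>")

text \<open>
  The compatibility of the braiding with the unitors, and the second hexagon, follow from
  the axioms below.
\<close>

locale symmetric_monoidal_category = monoidal_category C
  for C :: "('o, 'a, 'm) symmoncat_scheme" (structure) +
  assumes braiding_hom: "\<lbrakk>X \<in> Obj C; Y \<in> Obj C\<rbrakk> \<Longrightarrow> \<gamma> X Y \<in> Hom (X \<otimes> Y) (Y \<otimes> X)"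
    and braiding_natural: "\<lbrakk>f \<in> Hom X X'; g \<in> Hom Y Y'\<rbrakk>
      \<Longrightarrow> \<gamma> X' Y' \<cdot> (f \<boxtimes> g) = (g \<boxtimes> f) \<cdot> \<gamma> X Y"
    and braiding_symmetric: "\<lbrakk>X \<in> Obj C; Y \<in> Obj C\<rbrakk> \<Longrightarrow> \<gamma> Y X \<cdot> \<gamma> X Y = \<one> (X \<otimes> Y)"
    and hexagon: "\<lbrakk>X \<in> Obj C; Y \<in> Obj C; Z \<in> Obj C\<rbrakk>
      \<Longrightarrow> \<alpha> Y Z X \<cdot> \<gamma> X (Y \<otimes> Z) \<cdot> \<alpha> X Y Z
        = (\<one> Y \<boxtimes> \<gamma> X Z) \<cdot> \<alpha> Y X Z \<cdot> (\<gamma> X Y \<boxtimes> \<one> Z)"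

record ('o, 'a) monad_data =
  MObj :: "'o \<Rightarrow> 'o"
  MMap :: "'a \<Rightarrow> 'a"
  eta :: "'o \<Rightarrow> 'a"
  mu :: "'o \<Rightarrow> 'a"

record ('o, 'a) strong_monad_data = "('o, 'a) monad_data" +
  tau :: "'o \<Rightarrow> 'o \<Rightarrow> 'a"

locale monad = category C
  for C :: "('o, 'a, 'm) cat_scheme" (structure)
    and T :: "('o, 'a, 'n) monad_data_scheme" +
  assumes MObj_Obj: "X \<in> Obj C \<Longrightarrow> MObj T X \<in> Obj C"
    and MMap_hom: "f \<in> Hom X Y \<Longrightarrow> MMap T f \<in> Hom (MObj T X) (MObj T Y)"
    and MMap_Id: "X \<in> Obj C \<Longrightarrow> MMap T (\<one> X) = \<one> (MObj T X)"
    and MMap_comp: "\<lbrakk>f \<in> Hom X Y; g \<in> Hom Y Z\<rbrakk> \<Longrightarrow> MMap T (g \<cdot> f) = MMap T g \<cdot> MMap T f"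
    and eta_hom: "X \<in> Obj C \<Longrightarrow> eta T X \<in> Hom X (MObj T X)"
    and eta_natural: "f \<in> Hom X Y \<Longrightarrow> MMap T f \<cdot> eta T X = eta T Y \<cdot> f"
    and mu_hom: "X \<in> Obj C \<Longrightarrow> mu T X \<in> Hom (MObj T (MObj T X)) (MObj T X)"
    and mu_natural: "f \<in> Hom X Y \<Longrightarrow> MMap T f \<cdot> mu T X = mu T Y \<cdot> MMap T (MMap T f)"
    and mu_eta: "X \<in> Obj C \<Longrightarrow> mu T X \<cdot> eta T (MObj T X) = \<one> (MObj T X)"
    and mu_map_eta: "X \<in> Obj C \<Longrightarrow> mu T X \<cdot> MMap T (eta T X) = \<one> (MObj T X)"
    and mu_mu: "X \<in> Obj C \<Longrightarrow> mu T X \<cdot> mu T (MObj T X) = mu T X \<cdot> MMap T (mu T X)"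

locale strong_monad = symmetric_monoidal_category C + monad C T
  for C :: "('o, 'a, 'm) symmoncat_scheme" (structure)
    and T :: "('o, 'a, 'n) strong_monad_data_scheme" +
  assumes tau_hom: "\<lbrakk>X \<in> Obj C; Y \<in> Obj C\<rbrakk>
      \<Longrightarrow> tau T X Y \<in> Hom (X \<otimes> MObj T Y) (MObj T (X \<otimes> Y))"
    and tau_natural: "\<lbrakk>f \<in> Hom X X'; g \<in> Hom Y Y'\<rbrakk>
      \<Longrightarrow> MMap T (f \<boxtimes> g) \<cdot> tau T X Y = tau T X' Y' \<cdot> (f \<boxtimes> MMap T g)"
    and tau_lunitor: "X \<in> Obj C \<Longrightarrow> MMap T (\<ll> X) \<cdot> tau T \<I> X = \<ll> (MObj T X)"
    and tau_associator: "\<lbrakk>X \<in> Obj C; Y \<in> Obj C; Z \<in> Obj C\<rbrakk>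
      \<Longrightarrow> MMap T (\<alpha> X Y Z) \<cdot> tau T (X \<otimes> Y) Z
        = tau T X (Y \<otimes> Z) \<cdot> (\<one> X \<boxtimes> tau T Y Z) \<cdot> \<alpha> X Y (MObj T Z)"
    and tau_eta: "\<lbrakk>X \<in> Obj C; Y \<in> Obj C\<rbrakk>
      \<Longrightarrow> tau T X Y \<cdot> (\<one> X \<boxtimes> eta T Y) = eta T (X \<otimes> Y)"
    and tau_mu: "\<lbrakk>X \<in> Obj C; Y \<in> Obj C\<rbrakk>
      \<Longrightarrow> tau T X Y \<cdot> (\<one> X \<boxtimes> mu T Y)
        = mu T (X \<otimes> Y) \<cdot> MMap T (tau T X Y) \<cdot> tau T X (MObj T Y)"

definition right_strength :: "('o, 'a, 'm) symmoncat_scheme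
    \<Rightarrow> ('o, 'a, 'n) strong_monad_data_scheme \<Rightarrow> 'o \<Rightarrow> 'o \<Rightarrow> 'a"
  where "right_strength C T X Y =
    MMap T (\<gamma>\<^bsub>C\<^esub> Y X) \<cdot>\<^bsub>C\<^esub> tau T Y X \<cdot>\<^bsub>C\<^esub> \<gamma>\<^bsub>C\<^esub> (MObj T X) Y"

text \<open>The two canonical arrows from \<open>T X \<otimes> T Y\<close> to \<open>T (X \<otimes> Y)\<close>.\<close>

definition dst_left :: "('o, 'a, 'm) symmoncat_scheme
    \<Rightarrow> ('o, 'a, 'n) strong_monad_data_scheme \<Rightarrow> 'o \<Rightarrow> 'o \<Rightarrow> 'a"
  where "dst_left C T X Y =
    mu T (X \<otimes>\<^bsub>C\<^esub> Y) \<cdot>\<^bsub>C\<^esub> MMap T (right_strength C T X Y) \<cdot>\<^bsub>C\<^esub> tau T (MObj T X) Y"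

definition dst_right :: "('o, 'a, 'm) symmoncat_scheme
    \<Rightarrow> ('o, 'a, 'n) strong_monad_data_scheme \<Rightarrow> 'o \<Rightarrow> 'o \<Rightarrow> 'a"
  where "dst_right C T X Y =
    mu T (X \<otimes>\<^bsub>C\<^esub> Y) \<cdot>\<^bsub>C\<^esub> MMap T (tau T X Y) \<cdot>\<^bsub>C\<^esub> right_strength C T X (MObj T Y)"

locale commutative_strong_monad = strong_monad C T
  for C :: "('o, 'a, 'm) symmoncat_scheme" (structure)
    and T :: "('o, 'a, 'n) strong_monad_data_scheme" +
  assumes commutative: "\<lbrakk>X \<in> Obj C; Y \<in> Obj C\<rbrakk> \<Longrightarrow> dst_left C T X Y = dst_right C T X Y"

definition central_cone :: "('o, 'a, 'm) symmoncat_scheme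
    \<Rightarrow> ('o, 'a, 'n) strong_monad_data_scheme \<Rightarrow> 'o \<Rightarrow> 'o \<Rightarrow> 'a \<Rightarrow> bool"
  where "central_cone C T X Z i \<longleftrightarrow> Z \<in> Obj C \<and> i \<in> hom C Z (MObj T X) \<and>
    (\<forall>Y \<in> Obj C. dst_left C T X Y \<cdot>\<^bsub>C\<^esub> (i \<boxtimes>\<^bsub>C\<^esub> \<one>\<^bsub>C\<^esub> (MObj T Y))
      = dst_right C T X Y \<cdot>\<^bsub>C\<^esub> (i \<boxtimes>\<^bsub>C\<^esub> \<one>\<^bsub>C\<^esub> (MObj T Y)))"

definition central_cone_morphism :: "('o, 'a, 'm) symmoncat_scheme
    \<Rightarrow> 'o \<Rightarrow> 'a \<Rightarrow> 'o \<Rightarrow> 'a \<Rightarrow> 'a \<Rightarrow> bool"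
  where "central_cone_morphism C Z' i' Z i \<phi> \<longleftrightarrow> \<phi> \<in> hom C Z' Z \<and> i \<cdot>\<^bsub>C\<^esub> \<phi> = i'"

definition terminal_central_cone :: "('o, 'a, 'm) symmoncat_scheme
    \<Rightarrow> ('o, 'a, 'n) strong_monad_data_scheme \<Rightarrow> 'o \<Rightarrow> 'o \<Rightarrow> 'a \<Rightarrow> bool"
  where "terminal_central_cone C T X Z i \<longleftrightarrow> central_cone C T X Z i \<and>
    (\<forall>Z' i'. central_cone C T X Z' i' \<longrightarrow> (\<exists>!\<phi>. central_cone_morphism C Z' i' Z i \<phi>))"

locale centralisable_strong_monad = strong_monad C T
  for C :: "('o, 'a, 'm) symmoncat_scheme" (structure)
    and T :: "('o, 'a, 'n) strong_monad_data_scheme" +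
  assumes centralisable: "X \<in> Obj C \<Longrightarrow> \<exists>Z i. terminal_central_cone C T X Z i"

locale strong_monad_morphism = S: strong_monad C S + T: strong_monad C T
  for C :: "('o, 'a, 'm) symmoncat_scheme" (structure)
    and S :: "('o, 'a, 'n) strong_monad_data_scheme"
    and T :: "('o, 'a, 'k) strong_monad_data_scheme"
    and \<iota> :: "'o \<Rightarrow> 'a" +
  assumes component_hom: "X \<in> Obj C \<Longrightarrow> \<iota> X \<in> Hom (MObj S X) (MObj T X)"
    and component_natural: "f \<in> Hom X Y \<Longrightarrow> MMap T f \<cdot> \<iota> X = \<iota> Y \<cdot> MMap S f"
    and component_eta: "X \<in> Obj C \<Longrightarrow> \<iota> X \<cdot> eta S X = eta T X"
    and component_mu: "X \<in> Obj C
      \<Longrightarrow> \<iota> X \<cdot> mu S X = mu T X \<cdot> MMap T (\<iota> X) \<cdot> \<iota> (MObj S X)"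
    and component_tau: "\<lbrakk>X \<in> Obj C; Y \<in> Obj C\<rbrakk>
      \<Longrightarrow> \<iota> (X \<otimes> Y) \<cdot> tau S X Y = tau T X Y \<cdot> (\<one> X \<boxtimes> \<iota> Y)"

text \<open>
  Monomorphisms in the category of strong monads on \<open>C\<close>. Composition there is componentwise,
  and two morphisms are equal if their components agree at every object of \<open>C\<close>.
\<close>

definition strong_monad_mono :: "('o, 'a, 'm) symmoncat_scheme
    \<Rightarrow> ('o, 'a) strong_monad_data \<Rightarrow> ('o, 'a) strong_monad_data \<Rightarrow> ('o \<Rightarrow> 'a) \<Rightarrow> bool"
  where "strong_monad_mono C S T \<iota> \<longleftrightarrow> strong_monad_morphism C S T \<iota> \<and>
    (\<forall>(R :: ('o, 'a) strong_monad_data) f g.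
      strong_monad_morphism C R S f \<longrightarrow> strong_monad_morphism C R S g \<longrightarrow>
      (\<forall>X \<in> Obj C. \<iota> X \<cdot>\<^bsub>C\<^esub> f X = \<iota> X \<cdot>\<^bsub>C\<^esub> g X) \<longrightarrow> (\<forall>X \<in> Obj C. f X = g X))"

definition strong_submonad :: "('o, 'a, 'm) symmoncat_scheme
    \<Rightarrow> ('o, 'a) strong_monad_data \<Rightarrow> ('o, 'a) strong_monad_data \<Rightarrow> bool"
  where "strong_submonad C S T \<longleftrightarrow> (\<exists>\<iota>. strong_monad_mono C S T \<iota>)"

definition commutative_submonad :: "('o, 'a, 'm) symmoncat_scheme
    \<Rightarrow> ('o, 'a) strong_monad_data \<Rightarrow> ('o, 'a) strong_monad_data \<Rightarrow> bool"
  where "commutative_submonad C S T \<longleftrightarrow> commutative_strong_monad C S \<and> strong_submonad C S T"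

end

theory Submission
  imports Defs
begin

text \<open>
  Central cones are closed under everything a monad does: the unit \<open>\<eta>\<^sub>X\<close> is central, and if \<open>i\<close>, \<open>j\<close>
  are central then so are \<open>T f \<cdot> i\<close>, \<open>i \<cdot> f\<close>, \<open>\<tau> \<cdot> (X \<otimes> i)\<close> and the Kleisli composite
  \<open>\<mu> \<cdot> T i \<cdot> j\<close>. The last two are the substantial ones. The strength case uses that the left and right
  strength associate, so that \<open>\<tau>\<close> intertwines the two double strengths at \<open>X \<otimes> Y\<close> with those at \<open>Y\<close>.
  By terminality the corresponding arrows factor through \<open>\<iota>\<close>, which yields the structure of \<open>\<Z>\<close>.
  Closure under precomposition and uniqueness of factorisations make every \<open>\<iota>\<^sub>X\<close> monic, so all
  equations for \<open>\<Z>\<close>, commutativity included, can be checked after composing with \<open>\<iota>\<close>, where they are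
  equations for \<open>T\<close> or centrality itself.
\<close>

section \<open>Categories and monads in terms of domains and codomains\<close>

text \<open>
  With typing expressed by equations between domains and codomains, the simplifier can discharge the side
  conditions of associativity and interchange; a rule for \<open>g \<cdot> f\<close> gets a companion for
  \<open>g \<cdot> f \<cdot> k\<close> by \<open>comp_extend\<close>. Naturality is oriented so that images of arrows move to the right of
  \<open>\<eta>\<close>, \<open>\<mu>\<close> and \<open>\<tau>\<close>.
\<close>

context category
begin

lemma hom_iff: "f \<in> Hom X Y \<longleftrightarrow> f \<in> Arr C \<and> Dom C f = X \<and> Cod C f = Y"
  by (simp add: hom_def)

lemma arr_Id [simp]:
  assumes "X \<in> Obj C"
  shows "\<one> X \<in> Arr C" "Dom C (\<one> X) = X" "Cod C (\<one> X) = X"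
  using Id_hom[OF assms] by (auto simp: hom_iff)

lemma arr_comp [simp]:
  assumes "f \<in> Arr C" "g \<in> Arr C" "Dom C g = Cod C f"
  shows "g \<cdot> f \<in> Arr C" "Dom C (g \<cdot> f) = Dom C f" "Cod C (g \<cdot> f) = Cod C g"
  using comp_hom[of f "Dom C f" "Cod C f" g "Cod C g"] assms by (auto simp: hom_iff)

lemma comp_Id_arr [simp]: "\<lbrakk>f \<in> Arr C; Dom C f = X\<rbrakk> \<Longrightarrow> f \<cdot> \<one> X = f"
  using comp_Id by (auto simp: hom_iff)

lemma Id_comp_arr [simp]: "\<lbrakk>f \<in> Arr C; Cod C f = Y\<rbrakk> \<Longrightarrow> \<one> Y \<cdot> f = f"
  using Id_comp by (auto simp: hom_iff)

lemma comp_assoc_arr [simp]: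
  "\<lbrakk>f \<in> Arr C; g \<in> Arr C; h \<in> Arr C; Dom C g = Cod C f; Dom C h = Cod C g\<rbrakk>
    \<Longrightarrow> (h \<cdot> g) \<cdot> f = h \<cdot> (g \<cdot> f)"
  using comp_assoc by (auto simp: hom_iff)

lemma comp_extend:
  assumes "g \<cdot> f = h" "f \<in> Arr C" "g \<in> Arr C" "Dom C g = Cod C f"
    and "k \<in> Arr C" "Cod C k = Dom C f"
  shows "g \<cdot> (f \<cdot> k) = h \<cdot> k"
  using assms(1) comp_assoc_arr[of k f g] assms(2-) by simp

declare Dom_Obj [simp] Cod_Obj [simp]

end

section \<open>Typing, interchange and associators in monoidal categories\<close>

context monoidal_category
begin

declare tensor_Obj [simp] unit_Obj [simp] tensor_Id [simp]

lemma arr_tensor [simp]: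
  assumes "f \<in> Arr C" "g \<in> Arr C"
  shows "f \<boxtimes> g \<in> Arr C" "Dom C (f \<boxtimes> g) = Dom C f \<otimes> Dom C g"
    "Cod C (f \<boxtimes> g) = Cod C f \<otimes> Cod C g"
  using tensor_hom[of f "Dom C f" "Cod C f" g "Dom C g" "Cod C g"] assms
  by (auto simp: hom_iff)

lemma interchange [simp]:
  "\<lbrakk>f \<in> Arr C; f' \<in> Arr C; g \<in> Arr C; g' \<in> Arr C; Dom C f' = Cod C f; Dom C g' = Cod C g\<rbrakk>
    \<Longrightarrow> (f' \<boxtimes> g') \<cdot> (f \<boxtimes> g) = (f' \<cdot> f) \<boxtimes> (g' \<cdot> g)"
  using tensor_comp by (auto simp: hom_iff)

lemma interchange_extend [simp]:
  "\<lbrakk>f \<in> Arr C; f' \<in> Arr C; g \<in> Arr C; g' \<in> Arr C; Dom C f' = Cod C f; Dom C g' = Cod C g;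
    k \<in> Arr C; Cod C k = Dom C f \<otimes> Dom C g\<rbrakk>
    \<Longrightarrow> (f' \<boxtimes> g') \<cdot> (f \<boxtimes> g) \<cdot> k = ((f' \<cdot> f) \<boxtimes> (g' \<cdot> g)) \<cdot> k"
  by (rule comp_extend) auto

lemma arr_associator [simp]:
  assumes "X \<in> Obj C" "Y \<in> Obj C" "Z \<in> Obj C"
  shows "\<alpha> X Y Z \<in> Arr C" "Dom C (\<alpha> X Y Z) = (X \<otimes> Y) \<otimes> Z"
    "Cod C (\<alpha> X Y Z) = X \<otimes> (Y \<otimes> Z)"
  using associator_iso[OF assms] by (auto simp: iso_arr_def hom_iff)

lemma arr_lunitor [simp]:
  assumes "X \<in> Obj C"
  shows "\<ll> X \<in> Arr C" "Dom C (\<ll> X) = \<I> \<otimes> X" "Cod C (\<ll> X) = X"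
  using lunitor_iso[OF assms] by (auto simp: iso_arr_def hom_iff)

lemma associator_natural_arr:
  "\<lbrakk>f \<in> Arr C; g \<in> Arr C; h \<in> Arr C; Cod C f = X; Cod C g = Y; Cod C h = Z\<rbrakk>
    \<Longrightarrow> \<alpha> X Y Z \<cdot> ((f \<boxtimes> g) \<boxtimes> h) = (f \<boxtimes> (g \<boxtimes> h)) \<cdot> \<alpha> (Dom C f) (Dom C g) (Dom C h)"
  using associator_natural by (auto simp: hom_iff)

lemma associator_inverse:
  assumes "X \<in> Obj C" "Y \<in> Obj C" "Z \<in> Obj C"
  obtains a where "a \<in> Arr C" "Dom C a = X \<otimes> (Y \<otimes> Z)" "Cod C a = (X \<otimes> Y) \<otimes> Z"
    "a \<cdot> \<alpha> X Y Z = \<one> ((X \<otimes> Y) \<otimes> Z)" "\<alpha> X Y Z \<cdot> a = \<one> (X \<otimes> (Y \<otimes> Z))"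
  using associator_iso[OF assms] by (auto simp: iso_arr_def hom_iff)

end

section \<open>Braidings\<close>

context symmetric_monoidal_category
begin

lemma arr_braiding [simp]:
  assumes "X \<in> Obj C" "Y \<in> Obj C"
  shows "\<gamma> X Y \<in> Arr C" "Dom C (\<gamma> X Y) = X \<otimes> Y" "Cod C (\<gamma> X Y) = Y \<otimes> X"
  using braiding_hom[OF assms] by (auto simp: hom_iff)

lemma braiding_natural_arr:
  "\<lbrakk>f \<in> Arr C; g \<in> Arr C; Cod C f = X; Cod C g = Y\<rbrakk>
    \<Longrightarrow> \<gamma> X Y \<cdot> (f \<boxtimes> g) = (g \<boxtimes> f) \<cdot> \<gamma> (Dom C f) (Dom C g)"
  using braiding_natural by (auto simp: hom_iff)

text \<open>Inserting \<open>\<gamma> V W\<close> and its inverse \<open>\<gamma> W V\<close>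
  completes the right side of the hexagon at \<open>W\<close>, \<open>X\<close>, \<open>V\<close>;
  on its left side the associator cancels against \<open>a\<close> and the large braidings against
  each other.\<close>

lemma hexagon_inverse:
  assumes [simp]: "X \<in> Obj C" "V \<in> Obj C" "W \<in> Obj C"
    and a [simp]: "a \<in> Arr C" "Dom C a = W \<otimes> (X \<otimes> V)" "Cod C a = (W \<otimes> X) \<otimes> V"
      "\<alpha> W X V \<cdot> a = \<one> (W \<otimes> (X \<otimes> V))"
  shows "\<alpha> X W V \<cdot> (\<gamma> W X \<boxtimes> \<one> V) \<cdot> a \<cdot> \<gamma> (X \<otimes> V) W = (\<one> X \<boxtimes> \<gamma> V W) \<cdot> \<alpha> X V W"
    (is "?l = ?r")
proof -
  note a_extend = comp_extend[OF a(4)]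
  have "?l = (\<one> X \<boxtimes> \<gamma> V W) \<cdot> ((\<one> X \<boxtimes> \<gamma> W V) \<cdot> \<alpha> X W V \<cdot> (\<gamma> W X \<boxtimes> \<one> V)) \<cdot> a \<cdot> \<gamma> (X \<otimes> V) W"
    by (simp add: braiding_symmetric)
  also have "\<dots> = (\<one> X \<boxtimes> \<gamma> V W) \<cdot> (\<alpha> X V W \<cdot> \<gamma> W (X \<otimes> V) \<cdot> \<alpha> W X V) \<cdot> a \<cdot> \<gamma> (X \<otimes> V) W"
    by (simp only: hexagon assms)
  also have "\<dots> = ?r"
    by (simp add: a_extend braiding_symmetric)
  finally show ?thesis .
qed

end

section \<open>Monads\<close>

context monad
begin

declare MObj_Obj [simp] MMap_Id [simp]

lemma arr_MMap [simp]:
  assumes "f \<in> Arr C"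
  shows "MMap T f \<in> Arr C" "Dom C (MMap T f) = MObj T (Dom C f)"
    "Cod C (MMap T f) = MObj T (Cod C f)"
  using MMap_hom[of f "Dom C f" "Cod C f"] assms by (auto simp: hom_iff)

lemma MMap_comp_arr [simp]:
  "\<lbrakk>f \<in> Arr C; g \<in> Arr C; Dom C g = Cod C f\<rbrakk> \<Longrightarrow> MMap T (g \<cdot> f) = MMap T g \<cdot> MMap T f"
  using MMap_comp by (auto simp: hom_iff)

text \<open>The simplifier splits \<open>MMap T\<close> over composites, so an equation between
  composites cannot be rewritten under \<open>MMap T\<close>; this carries it over in split
  form.\<close>

lemma MMap_square:
  assumes "g \<cdot> f = g' \<cdot> f'" "f \<in> Arr C" "g \<in> Arr C" "Dom C g = Cod C f"
    and "f' \<in> Arr C" "g' \<in> Arr C" "Dom C g' = Cod C f'"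
  shows "MMap T g \<cdot> MMap T f = MMap T g' \<cdot> MMap T f'"
  using assms by (simp flip: MMap_comp_arr)

lemma arr_eta [simp]:
  assumes "X \<in> Obj C"
  shows "eta T X \<in> Arr C" "Dom C (eta T X) = X" "Cod C (eta T X) = MObj T X"
  using eta_hom[OF assms] by (auto simp: hom_iff)

lemma arr_mu [simp]:
  assumes "X \<in> Obj C"
  shows "mu T X \<in> Arr C" "Dom C (mu T X) = MObj T (MObj T X)" "Cod C (mu T X) = MObj T X"
  using mu_hom[OF assms] by (auto simp: hom_iff)

lemma eta_natural_arr:
  "\<lbrakk>f \<in> Arr C; Dom C f = X\<rbrakk> \<Longrightarrow> MMap T f \<cdot> eta T X = eta T (Cod C f) \<cdot> f"
  using eta_natural by (auto simp: hom_iff)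

lemma mu_natural_arr:
  "\<lbrakk>f \<in> Arr C; Dom C f = X\<rbrakk> \<Longrightarrow> MMap T f \<cdot> mu T X = mu T (Cod C f) \<cdot> MMap T (MMap T f)"
  using mu_natural by (auto simp: hom_iff)

lemmas eta_natural_extend = comp_extend[OF eta_natural_arr]
lemmas mu_natural_extend = comp_extend[OF mu_natural_arr]
lemmas mu_eta_extend = comp_extend[OF mu_eta]
lemmas mu_map_eta_extend = comp_extend[OF mu_map_eta]
text \<open>Associativity is read so that it trades the image of a multiplication for an outer
  multiplication.\<close>

lemmas mu_mu_extend = comp_extend[OF mu_mu[symmetric]]

end

section \<open>Left and right strength\<close>

context strong_monad
begin

lemma arr_tau [simp]:
  assumes "X \<in> Obj C" "Y \<in> Obj C"
  shows "tau T X Y \<in> Arr C" "Dom C (tau T X Y) = X \<otimes> MObj T Y"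
    "Cod C (tau T X Y) = MObj T (X \<otimes> Y)"
  using tau_hom[OF assms] by (auto simp: hom_iff)

lemma tau_natural_arr:
  "\<lbrakk>f \<in> Arr C; g \<in> Arr C; Dom C f = X; Dom C g = Y\<rbrakk>
    \<Longrightarrow> MMap T (f \<boxtimes> g) \<cdot> tau T X Y = tau T (Cod C f) (Cod C g) \<cdot> (f \<boxtimes> MMap T g)"
  using tau_natural by (auto simp: hom_iff)

lemmas tau_natural_extend = comp_extend[OF tau_natural_arr]
lemmas tau_lunitor_extend = comp_extend[OF tau_lunitor]
lemmas tau_associator_extend = comp_extend[OF tau_associator]

text \<open>Interchange fuses neighbouring tensor products, so \<open>mu T Y\<close> rarely stands
  alone beside an identity; \<open>f\<close> and \<open>g\<close> absorb what has been fused with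
  it.\<close>

lemma tau_mu_tensor:
  assumes [simp]: "f \<in> Arr C" "g \<in> Arr C" "X = Cod C f" "Y \<in> Obj C"
    "Cod C g = MObj T (MObj T Y)"
  shows "tau T X Y \<cdot> (f \<boxtimes> (mu T Y \<cdot> g)) =
    mu T (X \<otimes> Y) \<cdot> MMap T (tau T X Y) \<cdot> tau T X (MObj T Y) \<cdot> (f \<boxtimes> g)"
  using comp_extend[OF tau_mu, of X Y "f \<boxtimes> g"] by simp

abbreviation rst where "rst \<equiv> right_strength C T"
abbreviation dl where "dl \<equiv> dst_left C T"
abbreviation dr where "dr \<equiv> dst_right C T"

lemma arr_rst [simp]:
  assumes "X \<in> Obj C" "Y \<in> Obj C"
  shows "rst X Y \<in> Arr C" "Dom C (rst X Y) = MObj T X \<otimes> Y" "Cod C (rst X Y) = MObj T (X \<otimes> Y)"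
  using assms by (simp_all add: right_strength_def)

lemma rst_natural:
  assumes [simp]: "f \<in> Arr C" "g \<in> Arr C" "Dom C f = X" "Dom C g = Y"
  shows "MMap T (f \<boxtimes> g) \<cdot> rst X Y = rst (Cod C f) (Cod C g) \<cdot> (MMap T f \<boxtimes> g)"
proof -
  have [simp]: "X \<in> Obj C" "Y \<in> Obj C"
    using assms Dom_Obj by blast+
  have "MMap T (f \<boxtimes> g) \<cdot> MMap T (\<gamma> Y X) = MMap T (\<gamma> (Cod C g) (Cod C f)) \<cdot> MMap T (g \<boxtimes> f)"
    by (rule MMap_square) (simp_all add: braiding_natural_arr)
  from comp_extend[OF this] show ?thesis
    by (simp add: right_strength_def tau_natural_extend braiding_natural_arr)
qed

lemmas rst_natural_extend = comp_extend[OF rst_natural]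

lemma rst_eta:
  assumes [simp]: "X \<in> Obj C" "Y \<in> Obj C"
  shows "rst X Y \<cdot> (eta T X \<boxtimes> \<one> Y) = eta T (X \<otimes> Y)"
  by (simp add: right_strength_def braiding_natural_arr comp_extend[OF tau_eta]
      eta_natural_extend braiding_symmetric)

lemma rst_mu:
  assumes [simp]: "X \<in> Obj C" "Y \<in> Obj C"
  shows "rst X Y \<cdot> (mu T X \<boxtimes> \<one> Y) = mu T (X \<otimes> Y) \<cdot> MMap T (rst X Y) \<cdot> rst (MObj T X) Y"
proof -
  \<comment> \<open>These two braidings meet where \<open>MMap T (rst X Y)\<close> follows
    \<open>rst (MObj T X) Y\<close>; once they cancel, the claim is \<open>tau_mu\<close> conjugated
    by braidings.\<close>
  have "MMap T (\<gamma> (MObj T X) Y) \<cdot> MMap T (\<gamma> Y (MObj T X)) \<cdot> k = k"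
    if "k \<in> Arr C" "Cod C k = MObj T (Y \<otimes> MObj T X)" for k
  proof -
    have "MMap T (\<gamma> (MObj T X) Y) \<cdot> MMap T (\<gamma> Y (MObj T X)) = \<one> (MObj T (Y \<otimes> MObj T X))"
      using MMap_comp_arr[of "\<gamma> Y (MObj T X)" "\<gamma> (MObj T X) Y"]
      by (simp add: braiding_symmetric)
    from comp_extend[OF this] that show ?thesis by simp
  qed
  then show ?thesis
    by (simp add: right_strength_def braiding_natural_arr comp_extend[OF tau_mu] mu_natural_extend)
qed

text \<open>The right strength is the left one conjugated by braidings, so moving \<open>W\<close>
  to the far left turns both strengths into one strength by \<open>W \<otimes> X\<close>; the
  hexagon then exchanges \<open>W\<close> and \<open>X\<close>, and the strength splits
  again.\<close>

lemma tau_rst_associator: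
  assumes [simp]: "X \<in> Obj C" "Y \<in> Obj C" "W \<in> Obj C"
  shows "MMap T (\<alpha> X Y W) \<cdot> rst (X \<otimes> Y) W \<cdot> (tau T X Y \<boxtimes> \<one> W) =
    tau T X (Y \<otimes> W) \<cdot> (\<one> X \<boxtimes> rst Y W) \<cdot> \<alpha> X (MObj T Y) W" (is "?l = ?r")
proof -
  obtain a where a [simp]: "a \<in> Arr C" "Dom C a = W \<otimes> (X \<otimes> MObj T Y)"
    "Cod C a = (W \<otimes> X) \<otimes> MObj T Y" "\<alpha> W X (MObj T Y) \<cdot> a = \<one> (W \<otimes> (X \<otimes> MObj T Y))"
    using associator_inverse[of W X "MObj T Y"] by auto
  \<comment> \<open>Inverting the associator in \<open>tau_associator\<close> fuses the two nested
    strengths.\<close>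
  have "tau T W (X \<otimes> Y) \<cdot> (\<one> W \<boxtimes> tau T X Y)
      = (tau T W (X \<otimes> Y) \<cdot> (\<one> W \<boxtimes> tau T X Y) \<cdot> \<alpha> W X (MObj T Y)) \<cdot> a"
    by simp
  also have "\<dots> = MMap T (\<alpha> W X Y) \<cdot> tau T (W \<otimes> X) Y \<cdot> a"
    by (subst tau_associator[symmetric]) simp_all
  finally have tau: "tau T W (X \<otimes> Y) \<cdot> (\<one> W \<boxtimes> tau T X Y) = \<dots>" .
  have "?l = MMap T (\<alpha> X Y W \<cdot> \<gamma> W (X \<otimes> Y) \<cdot> \<alpha> W X Y) \<cdot> tau T (W \<otimes> X) Y \<cdot> a
      \<cdot> \<gamma> (X \<otimes> MObj T Y) W"
    by (simp add: right_strength_def braiding_natural_arr comp_extend[OF tau])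
  also have "\<dots> = MMap T ((\<one> X \<boxtimes> \<gamma> W Y) \<cdot> \<alpha> X W Y \<cdot> (\<gamma> W X \<boxtimes> \<one> Y)) \<cdot> tau T (W \<otimes> X) Y \<cdot> a
      \<cdot> \<gamma> (X \<otimes> MObj T Y) W"
    by (simp only: hexagon assms)
  \<comment> \<open>Naturality moves \<open>\<gamma> W X\<close> before the fused strength, which
    becomes one by \<open>X \<otimes> W\<close> and splits with \<open>X\<close> outermost. The
    remaining braidings have the shape of \<open>hexagon_inverse\<close>.\<close>
  also have "\<dots> = tau T X (Y \<otimes> W) \<cdot> (\<one> X \<boxtimes> (MMap T (\<gamma> W Y) \<cdot> tau T W Y))
      \<cdot> \<alpha> X W (MObj T Y) \<cdot> (\<gamma> W X \<boxtimes> \<one> (MObj T Y)) \<cdot> a \<cdot> \<gamma> (X \<otimes> MObj T Y) W"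
    by (simp add: tau_natural_extend tau_associator_extend)
  also have "\<dots> = ?r"
    by (simp add: hexagon_inverse right_strength_def)
  finally show ?thesis .
qed

section \<open>The two double strengths\<close>

lemma arr_dst [simp]:
  assumes "X \<in> Obj C" "Y \<in> Obj C"
  shows "dl X Y \<in> Arr C" "Dom C (dl X Y) = MObj T X \<otimes> MObj T Y" "Cod C (dl X Y) = MObj T (X \<otimes> Y)"
    and "dr X Y \<in> Arr C" "Dom C (dr X Y) = MObj T X \<otimes> MObj T Y" "Cod C (dr X Y) = MObj T (X \<otimes> Y)"
  using assms by (simp_all add: dst_left_def dst_right_def)


lemma dst_natural:
  assumes [simp]: "f \<in> Arr C" "g \<in> Arr C" "Dom C f = X" "Dom C g = Y"
  shows "MMap T (f \<boxtimes> g) \<cdot> dl X Y = dl (Cod C f) (Cod C g) \<cdot> (MMap T f \<boxtimes> MMap T g)"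
    and "MMap T (f \<boxtimes> g) \<cdot> dr X Y = dr (Cod C f) (Cod C g) \<cdot> (MMap T f \<boxtimes> MMap T g)"
proof -
  have [simp]: "X \<in> Obj C" "Y \<in> Obj C"
    using assms Dom_Obj by blast+
  have "MMap T (MMap T (f \<boxtimes> g)) \<cdot> MMap T (rst X Y)
      = MMap T (rst (Cod C f) (Cod C g)) \<cdot> MMap T (MMap T f \<boxtimes> g)"
    by (rule MMap_square) (simp_all add: rst_natural)
  from comp_extend[OF this]
  show "MMap T (f \<boxtimes> g) \<cdot> dl X Y = dl (Cod C f) (Cod C g) \<cdot> (MMap T f \<boxtimes> MMap T g)"
    by (simp add: dst_left_def mu_natural_extend tau_natural_arr)
  have "MMap T (MMap T (f \<boxtimes> g)) \<cdot> MMap T (tau T X Y)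
      = MMap T (tau T (Cod C f) (Cod C g)) \<cdot> MMap T (f \<boxtimes> MMap T g)"
    by (rule MMap_square) (simp_all add: tau_natural_arr)
  from comp_extend[OF this]
  show "MMap T (f \<boxtimes> g) \<cdot> dr X Y = dr (Cod C f) (Cod C g) \<cdot> (MMap T f \<boxtimes> MMap T g)"
    by (simp add: dst_right_def mu_natural_extend rst_natural)
qed

text \<open>In \<open>dl\<close> the unit passes under \<open>T\<close> by naturality of the
  strength and cancels by \<open>mu_map_eta\<close>; in \<open>dr\<close> it moves outside and
  cancels by \<open>mu_eta\<close>. The common value makes the unit central.\<close>

lemma dst_eta:
  assumes [simp]: "X \<in> Obj C" "Y \<in> Obj C"
  shows "dl X Y \<cdot> (eta T X \<boxtimes> \<one> (MObj T Y)) = tau T X Y"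
    and "dr X Y \<cdot> (eta T X \<boxtimes> \<one> (MObj T Y)) = tau T X Y"
proof -
  have tau: "tau T (MObj T X) Y \<cdot> (eta T X \<boxtimes> \<one> (MObj T Y)) = MMap T (eta T X \<boxtimes> \<one> Y) \<cdot> tau T X Y"
    by (simp add: tau_natural_arr)
  have "MMap T (rst X Y) \<cdot> MMap T (eta T X \<boxtimes> \<one> Y) = MMap T (eta T (X \<otimes> Y))"
    using arg_cong[OF rst_eta, of X Y "MMap T"] by simp
  from comp_extend[OF this]
  show "dl X Y \<cdot> (eta T X \<boxtimes> \<one> (MObj T Y)) = tau T X Y"
    by (simp add: dst_left_def tau mu_map_eta_extend)
  show "dr X Y \<cdot> (eta T X \<boxtimes> \<one> (MObj T Y)) = tau T X Y"
    by (simp add: dst_right_def rst_eta eta_natural_arr mu_eta_extend)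
qed

text \<open>With two layers of \<open>T\<close> over \<open>X\<close>, \<open>dl\<close> handles
  \<open>Y\<close> before both layers and \<open>dr\<close> after both. The right sides isolate one
  layer each, so that \<open>Y\<close> can later be moved past them one at a time.\<close>

lemma dst_mu:
  assumes [simp]: "X \<in> Obj C" "Y \<in> Obj C"
  shows "dl X Y \<cdot> (mu T X \<boxtimes> \<one> (MObj T Y)) = mu T (X \<otimes> Y) \<cdot> MMap T (rst X Y) \<cdot> dl (MObj T X) Y"
    and "dr X Y \<cdot> (mu T X \<boxtimes> \<one> (MObj T Y))
      = mu T (X \<otimes> Y) \<cdot> MMap T (dr X Y) \<cdot> rst (MObj T X) (MObj T Y)"
proof -
  have tau: "tau T (MObj T X) Y \<cdot> (mu T X \<boxtimes> \<one> (MObj T Y))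
      = MMap T (mu T X \<boxtimes> \<one> Y) \<cdot> tau T (MObj T (MObj T X)) Y"
    by (simp add: tau_natural_arr)
  have "MMap T (rst X Y) \<cdot> MMap T (mu T X \<boxtimes> \<one> Y)
      = MMap T (mu T (X \<otimes> Y)) \<cdot> MMap T (MMap T (rst X Y) \<cdot> rst (MObj T X) Y)"
    by (rule MMap_square) (simp_all add: rst_mu)
  from comp_extend[OF this]
  show "dl X Y \<cdot> (mu T X \<boxtimes> \<one> (MObj T Y)) = mu T (X \<otimes> Y) \<cdot> MMap T (rst X Y) \<cdot> dl (MObj T X) Y"
    by (simp add: dst_left_def tau mu_mu_extend mu_natural_extend)
  show "dr X Y \<cdot> (mu T X \<boxtimes> \<one> (MObj T Y))
      = mu T (X \<otimes> Y) \<cdot> MMap T (dr X Y) \<cdot> rst (MObj T X) (MObj T Y)"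
    by (simp add: dst_right_def rst_mu mu_natural_extend mu_mu_extend)
qed

text \<open>\<open>X\<close> acts as a passive parameter: the ingredients of a double strength,
  namely both strengths and \<mu>, are each compatible with \<open>tau\<close> by
  \<open>tau_associator\<close>, \<open>tau_rst_associator\<close> and
  \<open>tau_mu\<close>.\<close>

lemma tau_dst_associator:
  assumes [simp]: "X \<in> Obj C" "Y \<in> Obj C" "W \<in> Obj C"
  shows "MMap T (\<alpha> X Y W) \<cdot> dl (X \<otimes> Y) W \<cdot> (tau T X Y \<boxtimes> \<one> (MObj T W)) =
      tau T X (Y \<otimes> W) \<cdot> (\<one> X \<boxtimes> dl Y W) \<cdot> \<alpha> X (MObj T Y) (MObj T W)"
    and "MMap T (\<alpha> X Y W) \<cdot> dr (X \<otimes> Y) W \<cdot> (tau T X Y \<boxtimes> \<one> (MObj T W)) =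
      tau T X (Y \<otimes> W) \<cdot> (\<one> X \<boxtimes> dr Y W) \<cdot> \<alpha> X (MObj T Y) (MObj T W)"
proof -
  have tau: "tau T (MObj T (X \<otimes> Y)) W \<cdot> (tau T X Y \<boxtimes> \<one> (MObj T W))
      = MMap T (tau T X Y \<boxtimes> \<one> W) \<cdot> tau T (X \<otimes> MObj T Y) W"
    by (simp add: tau_natural_arr)
  have "MMap T (MMap T (\<alpha> X Y W) \<cdot> rst (X \<otimes> Y) W) \<cdot> MMap T (tau T X Y \<boxtimes> \<one> W)
      = MMap T (tau T X (Y \<otimes> W)) \<cdot> MMap T ((\<one> X \<boxtimes> rst Y W) \<cdot> \<alpha> X (MObj T Y) W)"
    by (rule MMap_square) (simp_all add: tau_rst_associator)
  note square = this
  have rst: "MMap T (MMap T (\<alpha> X Y W)) \<cdot> MMap T (rst (X \<otimes> Y) W)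
        \<cdot> MMap T (tau T X Y \<boxtimes> \<one> W) \<cdot> k
      = MMap T (tau T X (Y \<otimes> W)) \<cdot> MMap T (\<one> X \<boxtimes> rst Y W) \<cdot> MMap T (\<alpha> X (MObj T Y) W) \<cdot> k"
    if "k \<in> Arr C" "Cod C k = MObj T ((X \<otimes> MObj T Y) \<otimes> W)" for k
    using comp_extend[OF square, of k] that by simp
  have "MMap T (\<alpha> X Y W) \<cdot> dl (X \<otimes> Y) W \<cdot> (tau T X Y \<boxtimes> \<one> (MObj T W)) =
      mu T (X \<otimes> Y \<otimes> W) \<cdot> MMap T (tau T X (Y \<otimes> W)) \<cdot> MMap T (\<one> X \<boxtimes> rst Y W)
        \<cdot> tau T X (MObj T Y \<otimes> W) \<cdot> (\<one> X \<boxtimes> tau T (MObj T Y) W) \<cdot> \<alpha> X (MObj T Y) (MObj T W)"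
    by (simp add: dst_left_def tau mu_natural_extend rst tau_associator)
  then show "MMap T (\<alpha> X Y W) \<cdot> dl (X \<otimes> Y) W \<cdot> (tau T X Y \<boxtimes> \<one> (MObj T W)) =
      tau T X (Y \<otimes> W) \<cdot> (\<one> X \<boxtimes> dl Y W) \<cdot> \<alpha> X (MObj T Y) (MObj T W)"
    by (simp add: dst_left_def tau_natural_extend comp_extend[OF tau_mu_tensor])
  have "MMap T (MMap T (\<alpha> X Y W)) \<cdot> MMap T (tau T (X \<otimes> Y) W)
      = MMap T (tau T X (Y \<otimes> W)) \<cdot> MMap T ((\<one> X \<boxtimes> tau T Y W) \<cdot> \<alpha> X Y (MObj T W))"
    by (rule MMap_square) (simp_all add: tau_associator)
  from comp_extend[OF this]
  show "MMap T (\<alpha> X Y W) \<cdot> dr (X \<otimes> Y) W \<cdot> (tau T X Y \<boxtimes> \<one> (MObj T W)) =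
      tau T X (Y \<otimes> W) \<cdot> (\<one> X \<boxtimes> dr Y W) \<cdot> \<alpha> X (MObj T Y) (MObj T W)"
    by (simp add: dst_right_def mu_natural_extend tau_rst_associator tau_natural_extend
        comp_extend[OF tau_mu_tensor])
qed

end

section \<open>Closure properties of central cones\<close>

context strong_monad
begin

lemma central_cone_iff:
  "central_cone C T X Z i \<longleftrightarrow> Z \<in> Obj C \<and> i \<in> Arr C \<and> Dom C i = Z \<and> Cod C i = MObj T X \<and>
    (\<forall>Y \<in> Obj C. dl X Y \<cdot> (i \<boxtimes> \<one> (MObj T Y)) = dr X Y \<cdot> (i \<boxtimes> \<one> (MObj T Y)))"
  by (auto simp: central_cone_def hom_iff)

text \<open>The tensor \<open>(i \<cdot> f) \<boxtimes> \<one>\<close> factors through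
  \<open>i \<boxtimes> \<one>\<close>. This closure is what later makes the components of \<iota>
  monic.\<close>

lemma central_cone_comp:
  assumes "central_cone C T X Z i" "X \<in> Obj C" "f \<in> Arr C" "Cod C f = Z"
  shows "central_cone C T X (Dom C f) (i \<cdot> f)"
proof -
  have "dl X Y \<cdot> ((i \<cdot> f) \<boxtimes> \<one> (MObj T Y)) = dr X Y \<cdot> ((i \<cdot> f) \<boxtimes> \<one> (MObj T Y))"
    if "Y \<in> Obj C" for Y
  proof -
    have "dl X Y \<cdot> (i \<boxtimes> \<one> (MObj T Y)) \<cdot> (f \<boxtimes> \<one> (MObj T Y))
        = (dr X Y \<cdot> (i \<boxtimes> \<one> (MObj T Y))) \<cdot> (f \<boxtimes> \<one> (MObj T Y))"
      by (rule comp_extend) (use assms that in \<open>auto simp: central_cone_iff\<close>)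
    with assms that show ?thesis by (simp add: central_cone_iff)
  qed
  with assms show ?thesis by (simp add: central_cone_iff)
qed

lemma central_cone_MMap:
  assumes "central_cone C T X Z i" "f \<in> Arr C" "Dom C f = X"
  shows "central_cone C T (Cod C f) Z (MMap T f \<cdot> i)"
proof -
  have [simp]: "X \<in> Obj C"
    using assms Dom_Obj by blast
  have "dl (Cod C f) Y \<cdot> ((MMap T f \<cdot> i) \<boxtimes> \<one> (MObj T Y))
      = dr (Cod C f) Y \<cdot> ((MMap T f \<cdot> i) \<boxtimes> \<one> (MObj T Y))" if [simp]: "Y \<in> Obj C" for Y
    using assms dst_natural[of f "\<one> Y" X Y, THEN comp_extend, of "i \<boxtimes> \<one> (MObj T Y)"]
    by (simp add: central_cone_iff)
  with assms show ?thesis by (simp add: central_cone_iff)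
qed

lemma central_cone_eta: "X \<in> Obj C \<Longrightarrow> central_cone C T X X (eta T X)"
  by (simp add: central_cone_iff dst_eta)

lemma central_cone_mu:
  assumes i: "central_cone C T X A i" and j: "central_cone C T A B j" and [simp]: "X \<in> Obj C"
  shows "central_cone C T X B (mu T X \<cdot> MMap T i \<cdot> j)"
proof -
  have [simp]: "A \<in> Obj C" "i \<in> Arr C" "Dom C i = A" "Cod C i = MObj T X"
    "B \<in> Obj C" "j \<in> Arr C" "Dom C j = B" "Cod C j = MObj T A"
    using i j by (simp_all add: central_cone_iff)
  have "dl X Y \<cdot> ((mu T X \<cdot> MMap T i \<cdot> j) \<boxtimes> \<one> (MObj T Y))
      = dr X Y \<cdot> ((mu T X \<cdot> MMap T i \<cdot> j) \<boxtimes> \<one> (MObj T Y))" if [simp]: "Y \<in> Obj C" for Y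
  proof -
    let ?I = "\<one> (MObj T Y)"
    \<comment> \<open>The multiplication must be separated for \<open>dst_mu\<close> to apply;
      interchange is switched off below because it would undo this.\<close>
    have split: "(mu T X \<cdot> MMap T i \<cdot> j) \<boxtimes> ?I = (mu T X \<boxtimes> ?I) \<cdot> ((MMap T i \<cdot> j) \<boxtimes> ?I)"
      by simp
    have dist: "dl X Y \<cdot> (i \<boxtimes> ?I) = dr X Y \<cdot> (i \<boxtimes> ?I)"
      "dl A Y \<cdot> (j \<boxtimes> ?I) = dr A Y \<cdot> (j \<boxtimes> ?I)"
      using i j by (simp_all add: central_cone_iff)
    have dl_i: "dl (MObj T X) Y \<cdot> ((MMap T i \<cdot> j) \<boxtimes> ?I) = MMap T (i \<boxtimes> \<one> Y) \<cdot> dl A Y \<cdot> (j \<boxtimes> ?I)"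
      using dst_natural(1)[of i "\<one> Y" A Y, THEN comp_extend, of "j \<boxtimes> ?I"] by simp
    have rst_i: "rst (MObj T X) (MObj T Y) \<cdot> ((MMap T i \<cdot> j) \<boxtimes> ?I)
        = MMap T (i \<boxtimes> ?I) \<cdot> rst A (MObj T Y) \<cdot> (j \<boxtimes> ?I)"
      using rst_natural[of i ?I A "MObj T Y", THEN comp_extend, of "j \<boxtimes> ?I"] by simp
    have tau_i: "MMap T (MMap T (i \<boxtimes> \<one> Y)) \<cdot> MMap T (tau T A Y)
        = MMap T (tau T (MObj T X) Y) \<cdot> MMap T (i \<boxtimes> ?I)"
      by (rule MMap_square) (simp_all add: tau_natural_arr)
    have dist_i: "MMap T (dl X Y) \<cdot> MMap T (i \<boxtimes> ?I) = MMap T (dr X Y) \<cdot> MMap T (i \<boxtimes> ?I)"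
      by (rule MMap_square) (simp_all add: dist)
    \<comment> \<open>Centrality of \<open>j\<close> moves \<open>Y\<close> past the outer layer,
      turning \<open>dl A Y\<close> into \<open>dr A Y\<close>.\<close>
    have "dl X Y \<cdot> ((mu T X \<cdot> MMap T i \<cdot> j) \<boxtimes> ?I)
        = mu T (X \<otimes> Y) \<cdot> MMap T (rst X Y) \<cdot> MMap T (i \<boxtimes> \<one> Y) \<cdot> dr A Y \<cdot> (j \<boxtimes> ?I)"
      unfolding split
      using dst_mu(1)[of X Y, THEN comp_extend, of "(MMap T i \<cdot> j) \<boxtimes> ?I"]
      by (simp add: dl_i dist del: interchange interchange_extend)
    \<comment> \<open>Regrouping by associativity of \<mu> exposes \<open>dl X Y\<close> under
      \<open>T\<close>, next to \<open>i\<close>.\<close>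
    also have "\<dots> = mu T (X \<otimes> Y) \<cdot> MMap T (dl X Y) \<cdot> MMap T (i \<boxtimes> ?I) \<cdot> rst A (MObj T Y) \<cdot> (j \<boxtimes> ?I)"
      by (simp add: dst_right_def dst_left_def mu_natural_extend mu_mu_extend
          comp_extend[OF tau_i])
    \<comment> \<open>Centrality of \<open>i\<close>, applied under \<open>T\<close>, moves
      \<open>Y\<close> past the inner layer.\<close>
    also have "\<dots> = dr X Y \<cdot> ((mu T X \<cdot> MMap T i \<cdot> j) \<boxtimes> ?I)"
      unfolding split
      using dst_mu(2)[of X Y, THEN comp_extend, of "(MMap T i \<cdot> j) \<boxtimes> ?I"]
      by (simp add: rst_i comp_extend[OF dist_i] del: interchange interchange_extend)
    finally show ?thesis .
  qed
  then show ?thesis by (simp add: central_cone_iff)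
qed

lemma central_cone_tau:
  assumes i: "central_cone C T Y A i" and [simp]: "X \<in> Obj C" "Y \<in> Obj C"
  shows "central_cone C T (X \<otimes> Y) (X \<otimes> A) (tau T X Y \<cdot> (\<one> X \<boxtimes> i))"
proof -
  have [simp]: "A \<in> Obj C" "i \<in> Arr C" "Dom C i = A" "Cod C i = MObj T Y"
    using i by (simp_all add: central_cone_iff)
  have "dl (X \<otimes> Y) W \<cdot> ((tau T X Y \<cdot> (\<one> X \<boxtimes> i)) \<boxtimes> \<one> (MObj T W))
      = dr (X \<otimes> Y) W \<cdot> ((tau T X Y \<cdot> (\<one> X \<boxtimes> i)) \<boxtimes> \<one> (MObj T W))"
    if [simp]: "W \<in> Obj C" for W
  proof -
    let ?i = "(tau T X Y \<cdot> (\<one> X \<boxtimes> i)) \<boxtimes> \<one> (MObj T W)"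
    \<comment> \<open>After reassociation the two sides differ only in
      \<open>d Y W \<cdot> (i \<boxtimes> \<one> (MObj T W))\<close>, where centrality of
      \<open>i\<close> applies.\<close>
    have assoc: "MMap T (\<alpha> X Y W) \<cdot> d (X \<otimes> Y) W \<cdot> ?i
        = tau T X (Y \<otimes> W) \<cdot> (\<one> X \<boxtimes> (d Y W \<cdot> (i \<boxtimes> \<one> (MObj T W)))) \<cdot> \<alpha> X A (MObj T W)"
      if "d = dl \<or> d = dr" for d
    proof -
      have [simp]: "d U V \<in> Arr C" "Dom C (d U V) = MObj T U \<otimes> MObj T V"
        "Cod C (d U V) = MObj T (U \<otimes> V)" if "U \<in> Obj C" "V \<in> Obj C" for U V
        using that \<open>d = dl \<or> d = dr\<close> by auto
      have "MMap T (\<alpha> X Y W) \<cdot> d (X \<otimes> Y) W \<cdot> (tau T X Y \<boxtimes> \<one> (MObj T W)) =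
          tau T X (Y \<otimes> W) \<cdot> (\<one> X \<boxtimes> d Y W) \<cdot> \<alpha> X (MObj T Y) (MObj T W)"
        using that tau_dst_associator by auto
      then have "(MMap T (\<alpha> X Y W) \<cdot> d (X \<otimes> Y) W) \<cdot> (tau T X Y \<boxtimes> \<one> (MObj T W)) = \<dots>"
        by simp
      from comp_extend[OF this, of "(\<one> X \<boxtimes> i) \<boxtimes> \<one> (MObj T W)"] show ?thesis
        by (simp add: associator_natural_arr)
    qed
    obtain a where a: "a \<in> Arr C" "Dom C a = X \<otimes> (Y \<otimes> W)" "Cod C a = (X \<otimes> Y) \<otimes> W"
      "a \<cdot> \<alpha> X Y W = \<one> ((X \<otimes> Y) \<otimes> W)"
      using associator_inverse[of X Y W] by auto
    \<comment> \<open>The associator is invertible, hence so is its image under \<open>T\<close>,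
      and it can be cancelled on the left.\<close>
    have cancel: "MMap T a \<cdot> MMap T (\<alpha> X Y W) = \<one> (MObj T ((X \<otimes> Y) \<otimes> W))"
      using a by (simp flip: MMap_comp_arr)
    have "MMap T (\<alpha> X Y W) \<cdot> dl (X \<otimes> Y) W \<cdot> ?i = MMap T (\<alpha> X Y W) \<cdot> dr (X \<otimes> Y) W \<cdot> ?i"
      using i assoc[of dl] assoc[of dr] by (simp add: central_cone_iff)
    then have "MMap T a \<cdot> MMap T (\<alpha> X Y W) \<cdot> dl (X \<otimes> Y) W \<cdot> ?i
        = MMap T a \<cdot> MMap T (\<alpha> X Y W) \<cdot> dr (X \<otimes> Y) W \<cdot> ?i"
      by simp
    with a show ?thesis by (simp add: comp_extend[OF cancel])
  qed
  then show ?thesis by (simp add: central_cone_iff)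
qed

end

section \<open>Strong monad structure reflected along monic components\<close>

text \<open>For \<open>S\<close> only typing is assumed, together with compatibility of \<iota> with
  the operations; the monad and strength laws of \<open>S\<close> are to be derived by cancelling
  \<iota>.\<close>

locale monic_subdata = strong_monad C T
  for C :: "('o, 'a, 'm) symmoncat_scheme" (structure)
    and T :: "('o, 'a, 'k) strong_monad_data_scheme" +
  fixes S :: "('o, 'a, 'n) strong_monad_data_scheme"
    and \<iota> :: "'o \<Rightarrow> 'a"
  assumes sub_MObj: "X \<in> Obj C \<Longrightarrow> MObj S X \<in> Obj C"
    and sub_MMap: "f \<in> Hom X Y \<Longrightarrow> MMap S f \<in> Hom (MObj S X) (MObj S Y)"
    and sub_eta: "X \<in> Obj C \<Longrightarrow> eta S X \<in> Hom X (MObj S X)"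
    and sub_mu: "X \<in> Obj C \<Longrightarrow> mu S X \<in> Hom (MObj S (MObj S X)) (MObj S X)"
    and sub_tau: "\<lbrakk>X \<in> Obj C; Y \<in> Obj C\<rbrakk> \<Longrightarrow> tau S X Y \<in> Hom (X \<otimes> MObj S Y) (MObj S (X \<otimes> Y))"
    and incl_hom: "X \<in> Obj C \<Longrightarrow> \<iota> X \<in> Hom (MObj S X) (MObj T X)"
    and incl_monic: "\<lbrakk>\<iota> X \<cdot> f = \<iota> X \<cdot> g; X \<in> Obj C; f \<in> Hom W (MObj S X); g \<in> Hom W (MObj S X)\<rbrakk>
      \<Longrightarrow> f = g"
    and incl_MMap: "f \<in> Hom X Y \<Longrightarrow> \<iota> Y \<cdot> MMap S f = MMap T f \<cdot> \<iota> X"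
    and incl_eta: "X \<in> Obj C \<Longrightarrow> \<iota> X \<cdot> eta S X = eta T X"
    and incl_mu: "X \<in> Obj C \<Longrightarrow> \<iota> X \<cdot> mu S X = mu T X \<cdot> MMap T (\<iota> X) \<cdot> \<iota> (MObj S X)"
    and incl_tau: "\<lbrakk>X \<in> Obj C; Y \<in> Obj C\<rbrakk>
      \<Longrightarrow> \<iota> (X \<otimes> Y) \<cdot> tau S X Y = tau T X Y \<cdot> (\<one> X \<boxtimes> \<iota> Y)"
begin

declare sub_MObj [simp]

lemma arr_sub_MMap [simp]:
  assumes "f \<in> Arr C"
  shows "MMap S f \<in> Arr C" "Dom C (MMap S f) = MObj S (Dom C f)"
    "Cod C (MMap S f) = MObj S (Cod C f)"
  using sub_MMap[of f "Dom C f" "Cod C f"] assms by (auto simp: hom_iff)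

lemma arr_sub [simp]:
  assumes "X \<in> Obj C"
  shows "eta S X \<in> Arr C" "Dom C (eta S X) = X" "Cod C (eta S X) = MObj S X"
    and "mu S X \<in> Arr C" "Dom C (mu S X) = MObj S (MObj S X)" "Cod C (mu S X) = MObj S X"
    and "\<iota> X \<in> Arr C" "Dom C (\<iota> X) = MObj S X" "Cod C (\<iota> X) = MObj T X"
  using sub_eta[OF assms] sub_mu[OF assms] incl_hom[OF assms] by (auto simp: hom_iff)

lemma arr_sub_tau [simp]:
  assumes "X \<in> Obj C" "Y \<in> Obj C"
  shows "tau S X Y \<in> Arr C" "Dom C (tau S X Y) = X \<otimes> MObj S Y"
    "Cod C (tau S X Y) = MObj S (X \<otimes> Y)"
  using sub_tau[OF assms] by (auto simp: hom_iff)

lemma incl_MMap_arr: "\<lbrakk>f \<in> Arr C; Cod C f = Y\<rbrakk> \<Longrightarrow> \<iota> Y \<cdot> MMap S f = MMap T f \<cdot> \<iota> (Dom C f)"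
  using incl_MMap by (auto simp: hom_iff)

lemma MMap_incl:
  "\<lbrakk>f \<in> Arr C; Cod C f = Y\<rbrakk>
    \<Longrightarrow> MMap T (\<iota> Y) \<cdot> MMap T (MMap S f) = MMap T (MMap T f) \<cdot> MMap T (\<iota> (Dom C f))"
  "X \<in> Obj C \<Longrightarrow> MMap T (\<iota> X) \<cdot> MMap T (eta S X) = MMap T (eta T X)"
  "X \<in> Obj C \<Longrightarrow> MMap T (\<iota> X) \<cdot> MMap T (mu S X)
    = MMap T (mu T X) \<cdot> MMap T (MMap T (\<iota> X)) \<cdot> MMap T (\<iota> (MObj S X))"
  "\<lbrakk>X \<in> Obj C; Y \<in> Obj C\<rbrakk>
    \<Longrightarrow> MMap T (\<iota> (X \<otimes> Y)) \<cdot> MMap T (tau S X Y) = MMap T (tau T X Y) \<cdot> MMap T (\<one> X \<boxtimes> \<iota> Y)"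
  by (auto simp: incl_MMap_arr incl_eta incl_mu incl_tau simp flip: MMap_comp_arr)

text \<open>Rewriting with these drives \<iota> to the right, replacing operations of
  \<open>S\<close> by those of \<open>T\<close>.\<close>

lemmas push_incl = incl_MMap_arr incl_eta incl_mu incl_tau MMap_incl

lemmas push_incl_extend = push_incl[THEN comp_extend]

lemma strong_monad_sub: "strong_monad C S"
proof (unfold_locales, goal_cases)
  case (1 X) then show ?case by simp
next
  case (2 f X Y) then show ?case by (rule sub_MMap)
next
  case (3 X) then show ?case
    by - (rule incl_monic[of X _ _ "MObj S X"], auto simp: hom_iff push_incl)
next
  case (4 f X Y g Z) then show ?case
    by - (rule incl_monic[of Z _ _ "MObj S X"],
      auto simp: hom_iff push_incl push_incl_extend)
next
  case (5 X) then show ?case by (rule sub_eta)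
next
  case (6 f X Y) then show ?case
    by - (rule incl_monic[of Y _ _ X],
      auto simp: hom_iff push_incl push_incl_extend eta_natural_arr)
next
  case (7 X) then show ?case by (rule sub_mu)
next
  case (8 f X Y) then show ?case
    by - (rule incl_monic[of Y _ _ "MObj S (MObj S X)"],
      auto simp: hom_iff push_incl push_incl_extend mu_natural_extend)
next
  case (9 X) then show ?case
    by - (rule incl_monic[of X _ _ "MObj S X"],
      auto simp: hom_iff push_incl push_incl_extend eta_natural_arr mu_eta_extend)
next
  case (10 X) then show ?case
    by - (rule incl_monic[of X _ _ "MObj S X"],
      auto simp: hom_iff push_incl push_incl_extend mu_map_eta_extend)
next
  case (11 X) then show ?case
    by - (rule incl_monic[of X _ _ "MObj S (MObj S (MObj S X))"],
      auto simp: hom_iff push_incl push_incl_extend mu_natural_extend mu_mu_extend)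
next
  case (12 X Y) then show ?case by (rule sub_tau)
next
  case (13 f X X' g Y Y') then show ?case
    by - (rule incl_monic[of "X' \<otimes> Y'" _ _ "X \<otimes> MObj S Y"],
      auto simp: hom_iff push_incl push_incl_extend tau_natural_extend)
next
  case (14 X) then show ?case
    by - (rule incl_monic[of X _ _ "\<I> \<otimes> MObj S X"],
      auto simp: hom_iff push_incl push_incl_extend tau_lunitor_extend lunitor_natural)
next
  case (15 X Y Z)
  \<comment> \<open>The instance is given explicitly because simplification turns
    \<open>\<one> X \<boxtimes> \<one> Y\<close> into \<open>\<one> (X \<otimes> Y)\<close>, which
    hides the pattern of the naturality rule.\<close>
  with associator_natural_arr[of "\<one> X" "\<one> Y" "\<iota> Z" X Y "MObj T Z"] show ?case
    by - (rule incl_monic[of "X \<otimes> Y \<otimes> Z" _ _ "(X \<otimes> Y) \<otimes> MObj S Z"],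
      auto simp: hom_iff push_incl push_incl_extend tau_associator_extend)
next
  case (16 X Y) then show ?case
    by - (rule incl_monic[of "X \<otimes> Y" _ _ "X \<otimes> Y"],
      auto simp: hom_iff push_incl push_incl_extend tau_eta)
next
  case (17 X Y) then show ?case
    by - (rule incl_monic[of "X \<otimes> Y" _ _ "X \<otimes> MObj S (MObj S Y)"],
      auto simp: hom_iff push_incl push_incl_extend tau_mu_tensor tau_natural_extend)
qed

lemma strong_monad_morphism_incl: "strong_monad_morphism C S T \<iota>"
proof -
  interpret S: strong_monad C S by (rule strong_monad_sub)
  show ?thesis
    by unfold_locales (auto simp: incl_hom incl_MMap incl_eta incl_mu incl_tau)
qed

end

section \<open>Strong monad morphisms and double strengths\<close>

context strong_monad_morphism
begin

lemma arr_component [simp]: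
  assumes "X \<in> Obj C"
  shows "\<iota> X \<in> Arr C" "Dom C (\<iota> X) = MObj S X" "Cod C (\<iota> X) = MObj T X"
  using component_hom[OF assms] by (auto simp: S.hom_iff)

lemma component_natural_arr:
  "\<lbrakk>f \<in> Arr C; Cod C f = Y\<rbrakk> \<Longrightarrow> \<iota> Y \<cdot> MMap S f = MMap T f \<cdot> \<iota> (Dom C f)"
  using component_natural by (auto simp: S.hom_iff)

lemma component_rst:
  assumes [simp]: "X \<in> Obj C" "Y \<in> Obj C"
  shows "\<iota> (X \<otimes> Y) \<cdot> S.rst X Y = T.rst X Y \<cdot> (\<iota> X \<boxtimes> \<one> Y)"
  by (simp add: right_strength_def component_natural_arr[THEN S.comp_extend]
      component_tau[THEN S.comp_extend] S.braiding_natural_arr)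

text \<open>Morphisms preserve each ingredient of a double strength. This lets commutativity of the
  source be tested in the target when the components are monic.\<close>

lemma component_dst:
  assumes [simp]: "X \<in> Obj C" "Y \<in> Obj C"
  shows "\<iota> (X \<otimes> Y) \<cdot> S.dl X Y = T.dl X Y \<cdot> (\<iota> X \<boxtimes> \<iota> Y)"
    and "\<iota> (X \<otimes> Y) \<cdot> S.dr X Y = T.dr X Y \<cdot> (\<iota> X \<boxtimes> \<iota> Y)"
proof -
  have "MMap T (\<iota> (X \<otimes> Y)) \<cdot> MMap T (S.rst X Y) = MMap T (T.rst X Y) \<cdot> MMap T (\<iota> X \<boxtimes> \<one> Y)"
    by (rule T.MMap_square) (simp_all add: component_rst)
  from S.comp_extend[OF this] show "\<iota> (X \<otimes> Y) \<cdot> S.dl X Y = T.dl X Y \<cdot> (\<iota> X \<boxtimes> \<iota> Y)"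
    by (simp add: dst_left_def component_mu[THEN S.comp_extend] component_tau
        component_natural_arr[THEN S.comp_extend] T.tau_natural_extend)
  have "MMap T (\<iota> (X \<otimes> Y)) \<cdot> MMap T (tau S X Y) = MMap T (tau T X Y) \<cdot> MMap T (\<one> X \<boxtimes> \<iota> Y)"
    by (rule T.MMap_square) (simp_all add: component_tau)
  from S.comp_extend[OF this] show "\<iota> (X \<otimes> Y) \<cdot> S.dr X Y = T.dr X Y \<cdot> (\<iota> X \<boxtimes> \<iota> Y)"
    by (simp add: dst_right_def component_mu[THEN S.comp_extend] component_rst
        component_natural_arr[THEN S.comp_extend] T.rst_natural_extend)
qed

end

section \<open>The centre\<close>

locale central_cones = strong_monad C T
  for C :: "('o, 'a, 'm) symmoncat_scheme" (structure)
    and T :: "('o, 'a, 'k) strong_monad_data_scheme" +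
  fixes Z :: "'o \<Rightarrow> 'o" and \<iota> :: "'o \<Rightarrow> 'a"
  assumes terminal: "X \<in> Obj C \<Longrightarrow> terminal_central_cone C T X (Z X) (\<iota> X)"
begin

lemma cone: "X \<in> Obj C \<Longrightarrow> central_cone C T X (Z X) (\<iota> X)"
  using terminal by (simp add: terminal_central_cone_def)

lemma arr_cone [simp]:
  assumes "X \<in> Obj C"
  shows "Z X \<in> Obj C" "\<iota> X \<in> Arr C" "Dom C (\<iota> X) = Z X" "Cod C (\<iota> X) = MObj T X"
  using cone[OF assms] by (simp_all add: central_cone_iff)

lemma ex1_lift:
  assumes "X \<in> Obj C" "central_cone C T X A i"
  shows "\<exists>!\<phi>. \<phi> \<in> Hom A (Z X) \<and> \<iota> X \<cdot> \<phi> = i"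
  using terminal[OF assms(1)] assms(2)
  by (simp add: terminal_central_cone_def central_cone_morphism_def)

text \<open>The composite \<open>\<iota> X \<cdot> f\<close> is again a central cone, and
  \<open>f\<close> and \<open>g\<close> are both factorisations of it through the terminal
  one.\<close>

lemma cone_monic:
  assumes "\<iota> X \<cdot> f = \<iota> X \<cdot> g" "X \<in> Obj C" "f \<in> Hom W (Z X)" "g \<in> Hom W (Z X)"
  shows "f = g"
proof -
  have "central_cone C T X W (\<iota> X \<cdot> f)"
    using central_cone_comp[OF cone, of X f] assms by (simp add: hom_iff)
  from ex1_lift[OF assms(2) this] assms show ?thesis by metis
qed

text \<open>The description is meaningful when \<open>i\<close> is a central cone at
  \<open>X\<close> with apex \<open>A\<close>, by \<open>ex1_lift\<close>.\<close>

definition lift :: "'o \<Rightarrow> 'o \<Rightarrow> 'a \<Rightarrow> 'a"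
  where "lift X A i = (THE \<phi>. \<phi> \<in> Hom A (Z X) \<and> \<iota> X \<cdot> \<phi> = i)"

lemma lift:
  assumes "X \<in> Obj C" "central_cone C T X A i"
  shows "lift X A i \<in> Hom A (Z X)" "\<iota> X \<cdot> lift X A i = i"
  using theI'[OF ex1_lift[OF assms]] by (simp_all add: lift_def)

definition centre :: "('o, 'a) strong_monad_data"
  where "centre = \<lparr>MObj = Z,
    MMap = (\<lambda>f. lift (Cod C f) (Z (Dom C f)) (MMap T f \<cdot> \<iota> (Dom C f))),
    eta = (\<lambda>X. lift X X (eta T X)),
    mu = (\<lambda>X. lift X (Z (Z X)) (mu T X \<cdot> MMap T (\<iota> X) \<cdot> \<iota> (Z X))),
    tau = (\<lambda>X Y. lift (X \<otimes> Y) (X \<otimes> Z Y) (tau T X Y \<cdot> (\<one> X \<boxtimes> \<iota> Y)))\<rparr>"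

sublocale monic_subdata C T centre \<iota>
proof (unfold_locales, goal_cases)
  \<comment> \<open>This is the cancellation property. The other conditions are typings and
    equations of lifts, available because the closure lemmas make each lifted arrow central.\<close>
  case (7 X f g W) then show ?case
    by (intro cone_monic[of X f g W]) (simp_all add: centre_def)
qed (auto simp: centre_def hom_iff lift[unfolded hom_iff] cone
    central_cone_MMap[OF cone] central_cone_eta central_cone_mu[OF cone cone]
    central_cone_tau[OF cone])

lemma commutative_centre: "commutative_strong_monad C centre"
proof -
  interpret incl: strong_monad_morphism C centre T \<iota>
    by (rule strong_monad_morphism_incl)
  show ?thesis
  proof
    fix X Y assume [simp]: "X \<in> Obj C" "Y \<in> Obj C"
    \<comment> \<open>Since \<open>\<iota> X \<boxtimes> \<iota> Y\<close> factors through
      \<open>\<iota> X \<boxtimes> \<one> (MObj T Y)\<close>, centrality of \<open>\<iota> X\<close>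
      alone suffices.\<close>
    have "dl X Y \<cdot> (\<iota> X \<boxtimes> \<one> (MObj T Y)) \<cdot> (\<one> (Z X) \<boxtimes> \<iota> Y)
        = (dr X Y \<cdot> (\<iota> X \<boxtimes> \<one> (MObj T Y))) \<cdot> (\<one> (Z X) \<boxtimes> \<iota> Y)"
      by (rule comp_extend) (use cone[of X] in \<open>auto simp: central_cone_iff\<close>)
    then have "\<iota> (X \<otimes> Y) \<cdot> dst_left C centre X Y = \<iota> (X \<otimes> Y) \<cdot> dst_right C centre X Y"
      by (simp add: incl.component_dst)
    then show "dst_left C centre X Y = dst_right C centre X Y"
      by (rule incl_monic) (simp_all add: hom_iff)
  qed
qed

end

theorem mainTheorem6:
  fixes C :: "('o, 'a) symmoncat"
    and T :: "('o, 'a) strong_monad_data"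
    and Z :: "'o \<Rightarrow> 'o"
    and \<iota> :: "'o \<Rightarrow> 'a"
  assumes "symmetric_monoidal_category C"
    and "centralisable_strong_monad C T"
    and "\<And>X. X \<in> Obj C \<Longrightarrow> terminal_central_cone C T X (Z X) (\<iota> X)"
  shows "\<exists>Zmap \<eta>Z \<mu>Z \<tau>Z.
    let ZZ = \<lparr>MObj = Z, MMap = Zmap, eta = \<eta>Z, mu = \<mu>Z, tau = \<tau>Z\<rparr> in
      commutative_strong_monad C ZZ \<and>
      strong_monad_mono C ZZ T \<iota> \<and>
      commutative_submonad C ZZ T"
proof -
  interpret centralisable_strong_monad C T by (rule assms(2))
  interpret central_cones C T Z \<iota>
    by unfold_locales (rule assms(3))
  have "strong_monad_mono C centre T \<iota>"
    unfolding strong_monad_mono_def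
  proof (intro conjI strong_monad_morphism_incl allI impI ballI)
    fix R :: "('o, 'a) strong_monad_data" and f g X
    assume f: "strong_monad_morphism C R centre f" and g: "strong_monad_morphism C R centre g"
      and eq: "\<forall>X \<in> Obj C. \<iota> X \<cdot>\<^bsub>C\<^esub> f X = \<iota> X \<cdot>\<^bsub>C\<^esub> g X" and X: "X \<in> Obj C"
    \<comment> \<open>Composition of morphisms is componentwise, so monic components make \<iota> a
      monomorphism.\<close>
    from eq X have "\<iota> X \<cdot>\<^bsub>C\<^esub> f X = \<iota> X \<cdot>\<^bsub>C\<^esub> g X" by blast
    then show "f X = g X"
      using X strong_monad_morphism.component_hom[OF f X] strong_monad_morphism.component_hom[OF g X]
      by (rule incl_monic)
  qed
  then have "commutative_strong_monad C centre \<and> strong_monad_mono C centre T \<iota>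
      \<and> commutative_submonad C centre T"
    using commutative_centre by (auto simp: commutative_submonad_def strong_submonad_def)
  \<comment> \<open>The fields of \<open>centre\<close> are the witnesses; its object map is the
    given \<open>Z\<close>.\<close>
  then show ?thesis
    unfolding centre_def Let_def by blast
qed

end
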